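(* Let $p$ be a prime, let $F\colon\mathbb{F}_p^n\to\mathbb{F}_p^m$ be an almost balanced surjective bent function and let $L\colon\mathbb{F}_p^m\to\mathbb{F}_p^k$ be a surjective linear mapping. Then: 1. If $F$ is of type $(+)$, then $L\circ F\colon\mathbb{F}_p^n\to\mathbb{F}_p^k$ is almost balanced of type $(+)$ as well. 2. If $F$ is of type $(-)$, then $L\circ F\colon\mathbb{F}_p^n\to\mathbb{F}_p^k$ is almost balanced of type $(-)$ as well. Consequently, if $F$ is of type $(+)$ (resp. type $(-)$), then every component bent function $x\mapsto\langle b,F(x)\rangle$, $b\in\mathbb{F}_p^m\setminus\{0\}$, is of type $(+)$ (resp. type $(-)$).
   Context: $\langle\cdot,\cdot\rangle$ is the standard scalar product on $\mathbb{F}_p^m$. A function $F\colon\mathbb{F}_p^n\to\mathbb{F}_p^m$ is bent (perfect nonlinear) if $|\{x: F(x+a)-F(x)=b\}|=p^{n-m}$ for all nonzero $a$ and all $b$. A bent function $F\colon\mathbb{F}_p^n\to\mathbb{F}_p^m$ is almost balanced of type $(+)$ if for some $\alpha\in\mathbb{F}_p^m$, $|F^{-1}(\alpha)|=p^{n-m}+p^{n/2}-p^{n/2-m}$ and $|F^{-1}(\beta)|=p^{n-m}-p^{n/2-m}$ for all $\beta\neq\alpha$; it is almost balanced of type $(-)$ if for some $\alpha$, $|F^{-1}(\alpha)|=p^{n-m}-p^{n/2}+p^{n/2-m}$ and $|F^{-1}(\beta)|=p^{n-m}+p^{n/2-m}$ for all $\beta\neq\alpha$. It is almost balanced if it is of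 type $(+)$ or $(-)$. For functions into $\mathbb{F}_p^k$ (or $\mathbb{F}_p$) replace $m$ by $k$ (or $1$). *)

theory Defs
  imports "HOL-Analysis.Analysis" "Berlekamp_Zassenhaus.Finite_Field"
begin

text \<open>
  The field with p elements is \<open>'p mod_ring\<close> with \<open>'p :: prime_card\<close> and p = \<open>CARD('p)\<close>;
  its n-dimensional coordinate space is \<open>'p mod_ring ^ 'n\<close> with n = \<open>CARD('n)\<close>.

  The codomain of a function is a group \<open>'b\<close>, so that the notions below apply both to
  \<open>'p mod_ring ^ 'm\<close> and to \<open>'p mod_ring\<close> itself. The number \<open>m\<close> has to be the dimension of
  the codomain: \<open>CARD('m)\<close> in the first case and 1 in the second.

  The exponents n - m, n/2 and n/2 - m can be negative or fractional, hence the real powers.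
\<close>

definition bent ::
    "nat \<Rightarrow> ('p::prime_card mod_ring ^ 'n \<Rightarrow> 'b::ab_group_add) \<Rightarrow> bool" where
  "bent m F \<longleftrightarrow>
     (\<forall>a b. a \<noteq> 0 \<longrightarrow>
        real (card {x. F (x + a) - F x = b}) =
          real CARD('p) powr (real CARD('n) - real m))"

definition almost_balanced_plus ::
    "nat \<Rightarrow> ('p::prime_card mod_ring ^ 'n \<Rightarrow> 'b::ab_group_add) \<Rightarrow> bool" where
  "almost_balanced_plus m F \<longleftrightarrow> bent m F \<and>
     (let p = real CARD('p); n = real CARD('n) in
      \<exists>\<alpha>. real (card (F -` {\<alpha>})) =
              p powr (n - real m) + p powr (n / 2) - p powr (n / 2 - real m) \<and>
           (\<forall>\<beta>. \<beta> \<noteq> \<alpha> \<longrightarrow>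
              real (card (F -` {\<beta>})) = p powr (n - real m) - p powr (n / 2 - real m)))"

definition almost_balanced_minus ::
    "nat \<Rightarrow> ('p::prime_card mod_ring ^ 'n \<Rightarrow> 'b::ab_group_add) \<Rightarrow> bool" where
  "almost_balanced_minus m F \<longleftrightarrow> bent m F \<and>
     (let p = real CARD('p); n = real CARD('n) in
      \<exists>\<alpha>. real (card (F -` {\<alpha>})) =
              p powr (n - real m) - p powr (n / 2) + p powr (n / 2 - real m) \<and>
           (\<forall>\<beta>. \<beta> \<noteq> \<alpha> \<longrightarrow>
              real (card (F -` {\<beta>})) = p powr (n - real m) + p powr (n / 2 - real m)))"

definition almost_balanced ::
    "nat \<Rightarrow> ('p::prime_card mod_ring ^ 'n \<Rightarrow> 'b::ab_group_add) \<Rightarrow> bool" where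
  "almost_balanced m F \<longleftrightarrow> almost_balanced_plus m F \<or> almost_balanced_minus m F"

definition scalar_prod_vec :: "'a::comm_ring ^ 'm \<Rightarrow> 'a ^ 'm \<Rightarrow> 'a" where
  "scalar_prod_vec b y = (\<Sum>i\<in>UNIV. b $ i * y $ i)"

end

theory Submission
  imports Defs
begin

text \<open>
  A surjective homomorphism \<open>G\<close> of finite groups has fibres of constant size, here \<open>p powr (m - k)\<close>.
  Summing the preimage sizes of \<open>F\<close> over a fibre of \<open>G\<close> multiplies the constant part
  by \<open>p powr (m - k)\<close>, while the excess \<open>\<plusminus>p powr (n / 2)\<close> at \<open>\<alpha>\<close> is picked up unchanged exactly
  once, in the fibre over \<open>G \<alpha>\<close>. Linear maps and scalar products are both such homomorphisms.
\<close>

text \<open>Translating by a preimage of \<open>c - d\<close> carries the fibre over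
  \<open>d\<close> bijectively onto the fibre over \<open>c\<close>, so the fibres partition the
  domain into \<open>CARD('c)\<close> blocks of equal size.\<close>

lemma card_vimage_singleton_hom:
  fixes G :: "'b::{ab_group_add,finite} \<Rightarrow> 'c::{ab_group_add,finite}"
  assumes "Modules.additive G" and "surj G"
  shows "CARD('b) = CARD('c) * card (G -` {c})"
proof -
  interpret Modules.additive G by fact
  have fibre: "card (G -` {d}) = card (G -` {c})" for d
  proof -
    obtain e where e: "G e = c - d" using \<open>surj G\<close> by (metis surjD)
    have "bij_betw (\<lambda>y. y + e) (G -` {d}) (G -` {c})"
      by (rule bij_betw_byWitness[where f' = "\<lambda>y. y - e"]) (auto simp: add diff e)
    then show ?thesis by (rule bij_betw_same_card)
  qed
  have "CARD('b) = card (\<Union>d. G -` {d})" by (rule arg_cong[where f = card]) auto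
  also have "\<dots> = (\<Sum>d\<in>UNIV. card (G -` {d}))" by (rule card_UN_disjoint) auto
  also have "\<dots> = (\<Sum>d\<in>(UNIV :: 'c set). card (G -` {c}))" using fibre by (rule sum.cong[OF refl])
  also have "\<dots> = CARD('c) * card (G -` {c})" by simp
  finally show ?thesis .
qed

lemma card_vimage_comp:
  fixes f :: "'a::finite \<Rightarrow> 'b::finite"
  shows "card ((\<lambda>x. G (f x)) -` {c}) = (\<Sum>y\<in>G -` {c}. card (f -` {y}))"
proof -
  have "(\<lambda>x. G (f x)) -` {c} = (\<Union>y\<in>G -` {c}. f -` {y})" by auto
  also have "card \<dots> = (\<Sum>y\<in>G -` {c}. card (f -` {y}))" by (rule card_UN_disjoint) auto
  finally show ?thesis .
qed

text \<open>The real exponent matches the definitions of bent and almost balanced and avoids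
  truncated subtraction.\<close>

lemma card_vimage_singleton_powr:
  fixes G :: "'b::{ab_group_add,finite} \<Rightarrow> 'c::{ab_group_add,finite}"
  assumes "Modules.additive G" and "surj G" and "q > 0"
    and "CARD('b) = q ^ m" and "CARD('c) = q ^ k"
  shows "real (card (G -` {c})) = real q powr (real m - real k)"
proof -
  have "real q ^ m = real q ^ k * real (card (G -` {c}))"
    using card_vimage_singleton_hom[OF assms(1,2), of c] assms(4,5)
    by (metis of_nat_mult of_nat_power)
  with \<open>q > 0\<close> show ?thesis by (simp add: powr_diff powr_realpow)
qed

text \<open>An additive \<open>G\<close> commutes with differences, so the derivative of the
  composition in direction \<open>a\<close> is \<open>G\<close> applied to that of \<open>F\<close>.
  All fibres of the latter have the same size, and a fibre of \<open>G\<close> collects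
  \<open>p powr (m - k)\<close> of them.\<close>

lemma bent_comp_hom:
  fixes F :: "'p::prime_card mod_ring ^ 'n \<Rightarrow> 'b::{ab_group_add,finite}"
    and G :: "'b \<Rightarrow> 'c::{ab_group_add,finite}"
  assumes "Modules.additive G" and "surj G" and "bent m F"
    and "CARD('b) = CARD('p) ^ m" and "CARD('c) = CARD('p) ^ k"
  shows "bent k (\<lambda>x. G (F x))"
  unfolding bent_def
proof (intro allI impI)
  interpret Modules.additive G by fact
  fix a :: "'p mod_ring ^ 'n" and c
  assume "a \<noteq> 0"
  let ?p = "real CARD('p)" and ?n = "real CARD('n)"
  let ?D = "\<lambda>x. F (x + a) - F x"
  have D: "real (card (?D -` {b})) = ?p powr (?n - real m)" for b
    using \<open>bent m F\<close> \<open>a \<noteq> 0\<close> by (simp add: bent_def vimage_def)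
  have "{x. G (F (x + a)) - G (F x) = c} = (\<lambda>x. G (?D x)) -` {c}"
    by (auto simp: diff)
  then have "real (card {x. G (F (x + a)) - G (F x) = c}) =
      (\<Sum>b\<in>G -` {c}. real (card (?D -` {b})))"
    by (simp add: card_vimage_comp[of G])
  also have "\<dots> = ?p powr (real m - real k) * ?p powr (?n - real m)"
    using card_vimage_singleton_powr[OF assms(1,2) _ assms(4,5)] by (simp add: D)
  also have "\<dots> = ?p powr (?n - real k)"
    by (simp flip: powr_add)
  finally show "real (card {x. G (F (x + a)) - G (F x) = c}) = ?p powr (?n - real k)" .
qed

text \<open>Treats both types at once: \<open>s = 1\<close> is type (+) and \<open>s = - 1\<close>
  is type (-). Writing the size as a constant plus an excess at \<alpha> lets sums over fibres
  split.\<close>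

definition almost_balanced_sign ::
    "real \<Rightarrow> nat \<Rightarrow> ('p::prime_card mod_ring ^ 'n \<Rightarrow> 'b::ab_group_add) \<Rightarrow> bool" where
  "almost_balanced_sign s m F \<longleftrightarrow> bent m F \<and>
     (\<exists>\<alpha>. \<forall>\<beta>. real (card (F -` {\<beta>})) =
        (real CARD('p) powr (real CARD('n) - real m)
          - s * real CARD('p) powr (real CARD('n) / 2 - real m))
        + (if \<beta> = \<alpha> then s * real CARD('p) powr (real CARD('n) / 2) else 0))"

lemma almost_balanced_plus_iff: "almost_balanced_plus m F \<longleftrightarrow> almost_balanced_sign 1 m F"
  unfolding almost_balanced_plus_def almost_balanced_sign_def Let_def
  by (intro conj_cong refl ex_cong1) (auto split: if_splits)

lemma almost_balanced_minus_iff: "almost_balanced_minus m F \<longleftrightarrow> almost_balanced_sign (- 1) m F"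
  unfolding almost_balanced_minus_def almost_balanced_sign_def Let_def
  by (intro conj_cong refl ex_cong1) (auto split: if_splits)

lemma almost_balanced_sign_comp_hom:
  fixes F :: "'p::prime_card mod_ring ^ 'n \<Rightarrow> 'b::{ab_group_add,finite}"
    and G :: "'b \<Rightarrow> 'c::{ab_group_add,finite}"
  assumes "Modules.additive G" and "surj G" and "almost_balanced_sign s m F"
    and "CARD('b) = CARD('p) ^ m" and "CARD('c) = CARD('p) ^ k"
  shows "almost_balanced_sign s k (\<lambda>x. G (F x))"
proof -
  let ?p = "real CARD('p)" and ?n = "real CARD('n)"
  let ?u = "\<lambda>m. ?p powr (?n - real m) - s * ?p powr (?n / 2 - real m)"
  let ?v = "s * ?p powr (?n / 2)"
  obtain \<alpha> where \<alpha>: "\<And>\<beta>. real (card (F -` {\<beta>})) = ?u m + (if \<beta> = \<alpha> then ?v else 0)"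
    using assms(3) unfolding almost_balanced_sign_def by blast
  have "real (card ((\<lambda>x. G (F x)) -` {\<gamma>})) = ?u k + (if \<gamma> = G \<alpha> then ?v else 0)" for \<gamma>
  proof -
    have "real (card ((\<lambda>x. G (F x)) -` {\<gamma>})) = real (card (G -` {\<gamma>})) * ?u m
        + (if \<gamma> = G \<alpha> then ?v else 0)"
      \<comment> \<open>The excess terms sum to \<open>?v\<close> exactly when \<alpha> lies in the
        fibre over \<gamma>, that is, when \<open>\<gamma> = G \<alpha>\<close>.\<close>
      by (simp only: card_vimage_comp[of G] of_nat_sum \<alpha> sum.distrib)
        auto
    \<comment> \<open>The factor \<open>p powr (m - k)\<close> turns the exponents
      \<open>n - m\<close> and \<open>n / 2 - m\<close> into \<open>n - k\<close> and
      \<open>n / 2 - k\<close>.\<close>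
    also have "real (card (G -` {\<gamma>})) * ?u m = ?u k"
      by (simp add: card_vimage_singleton_powr[OF assms(1,2) _ assms(4,5)] right_diff_distrib
          mult.left_commute flip: powr_add)
    finally show ?thesis .
  qed
  with bent_comp_hom[OF assms(1,2) _ assms(4,5)] assms(3) show ?thesis
    unfolding almost_balanced_sign_def by blast
qed

lemma additive_scalar_prod_vec: "Modules.additive (scalar_prod_vec b)"
  by standard (simp add: scalar_prod_vec_def distrib_left sum.distrib)

lemma surj_scalar_prod_vec:
  fixes b :: "'a::field ^ 'm"
  assumes "b \<noteq> 0"
  shows "surj (scalar_prod_vec b)"
proof -
  from assms obtain i where i: "b $ i \<noteq> 0" by (auto simp: vec_eq_iff)
  \<comment> \<open>A vector supported on one coordinate where \<open>b\<close> is nonzero, scaled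
    to hit \<open>c\<close>.\<close>
  have "scalar_prod_vec b (axis i (c / b $ i)) = c" for c
  proof -
    have "b $ j * axis i (c / b $ i) $ j = (if j = i then c else 0)" for j
      using i by (auto simp: axis_def)
    then show ?thesis
      by (simp add: scalar_prod_vec_def)
  qed
  then show ?thesis by (rule surjI)
qed

theorem proposition3p11:
  fixes F :: "'p::prime_card mod_ring ^ 'n \<Rightarrow> 'p mod_ring ^ 'm"
  assumes "bent CARD('m) F"
    and "almost_balanced CARD('m) F"
    and "surj F"
  shows "(\<forall>L :: 'p mod_ring ^ 'm \<Rightarrow> 'p mod_ring ^ 'k.
            Vector_Spaces.linear (*s) (*s) L \<longrightarrow> surj L \<longrightarrow>
              (almost_balanced_plus CARD('m) F \<longrightarrow> almost_balanced_plus CARD('k) (L \<circ> F)) \<and>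
              (almost_balanced_minus CARD('m) F \<longrightarrow> almost_balanced_minus CARD('k) (L \<circ> F))) \<and>
         (almost_balanced_plus CARD('m) F \<longrightarrow>
            (\<forall>b. b \<noteq> 0 \<longrightarrow> almost_balanced_plus 1 (\<lambda>x. scalar_prod_vec b (F x)))) \<and>
         (almost_balanced_minus CARD('m) F \<longrightarrow>
            (\<forall>b. b \<noteq> 0 \<longrightarrow> almost_balanced_minus 1 (\<lambda>x. scalar_prod_vec b (F x))))"
proof -
  have linear: "almost_balanced_sign s CARD('k) (L \<circ> F)"
    if "Vector_Spaces.linear (*s) (*s) L" "surj L" "almost_balanced_sign s CARD('m) F"
    for s and L :: "'p mod_ring ^ 'm \<Rightarrow> 'p mod_ring ^ 'k"
  proof -
    have "Modules.additive L"
      using that(1) by (simp add: Modules.additive_def vec.linear_add)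
    from almost_balanced_sign_comp_hom[OF this that(2,3)] show ?thesis
      by (simp add: comp_def)
  qed
  \<comment> \<open>Here the codomain is the field itself, of size \<open>CARD('p) ^ 1\<close>, so
    \<open>k = 1\<close>.\<close>
  have component: "almost_balanced_sign s 1 (\<lambda>x. scalar_prod_vec b (F x))"
    if "b \<noteq> 0" "almost_balanced_sign s CARD('m) F" for s and b :: "'p mod_ring ^ 'm"
    using almost_balanced_sign_comp_hom[OF additive_scalar_prod_vec
        surj_scalar_prod_vec[OF that(1)] that(2)]
    by simp
  show ?thesis
    unfolding almost_balanced_plus_iff almost_balanced_minus_iff
    using linear component by blast
qed

end
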